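(* Let $G$ be an Abelian group, $A\subseteq G$ a finite set, and $\varepsilon, \beta \in (0,1)$ with $|A| \ge \varepsilon / (2 \beta^2)$. Let $C_0 = \varepsilon \log (1/\beta) / (3 \log (2|A|/\varepsilon))$. Then there exists a partition of $A$ into disjoint sets $A_1, \dots, A_t, \Omega$ such that: (1) for each $i=1,\dots,t$ there is a set $B_i\subseteq A_i$ with $|B_i|\ge\beta|A_i|$ such that for every $C\in(0,C_0]$ and all disjoint $E,F\subseteq B_i$ with $E\sqcup F=B_i$, $$\sum_{x\in G}(E\circ F)(x)\cdot(A_i\circ A_i)(x)\ge C\,\frac{|E|}{|A_i|}\frac{|F|}{|A_i|}\,T_2(A_i)$$ (i.e. each $A_i$ is strongly $\beta$-connected of degree $2$ with any constant $C\le C_0$); (2) $\sum_{i=1}^t T_2 (A_i) \ge (1-\varepsilon)\, T_2 (A)$.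
   Context: $\log$ denotes the logarithm to base $2$. Sets are identified with their indicator functions; $(f\circ g)(x)=\sum_s f(s)g(s-x)$. $T_2(A)$ is the number of quadruples $(a_1,a_2,a'_1,a'_2)\in A^4$ with $a_1+a_2=a'_1+a'_2$. *)

theory Defs
  imports Complex_Main "HOL-Library.Groups_Big_Fun" "HOL-Library.Indicator_Function"
    "HOL-Library.Disjoint_Sets"
begin

text \<open>
  \<^const>\<open>Sum_any\<close> sums over the whole group; it returns 0 when the summand has infinite support.
  It is only applied here to indicator functions of finite sets, where the support is finite.
\<close>

definition diff_conv :: "('a::ab_group_add \<Rightarrow> real) \<Rightarrow> ('a \<Rightarrow> real) \<Rightarrow> 'a \<Rightarrow> real"
    (infixl "\<circ>\<^sub>G" 75) where
  "(f \<circ>\<^sub>G g) x = Sum_any (\<lambda>s. f s * g (s - x))"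

definition T2 :: "'a::ab_group_add set \<Rightarrow> nat" where
  "T2 A = card {(a1, a2, a1', a2'). a1 \<in> A \<and> a2 \<in> A \<and> a1' \<in> A \<and> a2' \<in> A \<and> a1 + a2 = a1' + a2'}"

end

theory Submission
  imports Defs
begin

text \<open>
  If \<open>A\<close> is not strongly connected, every subset of density at least \<open>\<beta>\<close> splits into \<open>E\<close>, \<open>F\<close>
  with few solutions of \<open>e - f = a - a'\<close> over \<open>A\<close>; hence \<open>A\<close> can be split repeatedly until every
  piece is smaller than \<open>A\<close> by a factor \<open>\<beta>\<close>.
  One split loses at most \<open>4 C |E| |F| T\<^sub>2(A) / |A|\<^sup>2\<close> of the energy; as the pairs \<open>E \<times> F\<close> of
  different splits are disjoint, the losses add up to at most \<open>2 C T\<^sub>2(A)\<close>. Iterating on the pieces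
  takes at most \<open>log |A| / log (1/\<beta>)\<close> rounds, and by superadditivity of \<open>T\<^sub>2\<close> each round loses
  at most \<open>2 C T\<^sub>2(A)\<close>. Singletons are connected, so nothing has to be discarded.
\<close>

section \<open>Cross energy as a convolution sum\<close>

definition cross_energy :: "'a::ab_group_add set \<Rightarrow> 'a set \<Rightarrow> 'a set \<Rightarrow> nat" where
  "cross_energy E F A = card {(e, f, a, b). e \<in> E \<and> f \<in> F \<and> a \<in> A \<and> b \<in> A \<and> e - f = a - b}"

lemma finite_quadruples:
  assumes "finite A" "finite B" "finite C" "finite D"
  shows "finite {(a, b, c, d). a \<in> A \<and> b \<in> B \<and> c \<in> C \<and> d \<in> D \<and> R a b c d}"
  by (rule finite_subset[of _ "A \<times> B \<times> C \<times> D"]) (use assms in auto)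

lemma diff_conv_indicator:
  fixes E F :: "'a::ab_group_add set"
  assumes "finite E"
  shows "(indicator E \<circ>\<^sub>G indicator F) x = real (card {s \<in> E. s - x \<in> F})"
proof -
  have "(indicator E \<circ>\<^sub>G indicator F) x = (\<Sum>s\<in>E. indicator E s * indicator F (s - x))"
    unfolding diff_conv_def
    by (rule Sum_any.expand_superset) (use assms in \<open>auto simp: indicator_def\<close>)
  also have "\<dots> = (\<Sum>s\<in>E. if s - x \<in> F then 1 else 0)"
    by (rule sum.cong) (auto simp: indicator_def)
  also have "\<dots> = real (card {s \<in> E. s - x \<in> F})"
    using assms by (simp add: sum.If_cases Int_def)
  finally show ?thesis .
qed

text \<open>Sorting the quadruples by their common difference \<open>x = e - f = a - b\<close> gives
  one product set per \<open>x\<close>: such a quadruple is determined by \<open>x\<close>,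
  \<open>e\<close> and \<open>a\<close>.\<close>

lemma Sum_any_diff_conv:
  fixes E F A :: "'a::ab_group_add set"
  assumes "finite E" "finite F" "finite A"
  shows "Sum_any (\<lambda>x. (indicator E \<circ>\<^sub>G indicator F) x * (indicator A \<circ>\<^sub>G indicator A) x)
    = real (cross_energy E F A)"
proof -
  \<comment> \<open>Finite set of differences containing the support of the summand, so that
    \<open>Sum_any\<close> becomes an ordinary sum and not its default value 0.\<close>
  define D where "D = (\<lambda>(a, b). a - b) ` (A \<times> A)"
  define S where "S x = {s \<in> E. s - x \<in> F} \<times> {s \<in> A. s - x \<in> A}" for x
  have cancel: "x - (x - y) = y" for x y :: 'a by simp
  have fin: "finite D" "\<And>x. finite (S x)"
    using assms by (auto simp: D_def S_def)
  have "Sum_any (\<lambda>x. (indicator E \<circ>\<^sub>G indicator F) x * (indicator A \<circ>\<^sub>G indicator A) x)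
      = Sum_any (\<lambda>x. real (card (S x)))"
    using assms by (simp add: diff_conv_indicator S_def card_cartesian_product)
  also have "\<dots> = (\<Sum>x\<in>D. real (card (S x)))"
  proof (rule Sum_any.expand_superset[OF fin(1)])
    show "{x. real (card (S x)) \<noteq> 0} \<subseteq> D"
    proof
      fix x assume "x \<in> {x. real (card (S x)) \<noteq> 0}"
      then have "S x \<noteq> {}" by auto
      then obtain s where "s \<in> A" "s - x \<in> A" by (auto simp: S_def)
      then show "x \<in> D"
        unfolding D_def by (intro image_eqI[of _ _ "(s, s - x)"]) auto
    qed
  qed
  also have "\<dots> = real (card (Sigma D S))"
    using fin by simp
  also have "card (Sigma D S) = cross_energy E F A"
    unfolding cross_energy_def
  proof (rule bij_betw_same_card)
    show "bij_betw (\<lambda>(x, s, a). (s, s - x, a, a - x)) (Sigma D S)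
        {(e, f, a, b). e \<in> E \<and> f \<in> F \<and> a \<in> A \<and> b \<in> A \<and> e - f = a - b}"
    proof (rule bij_betwI[where g = "\<lambda>(e, f, a, b). (e - f, e, a)"])
      show "(\<lambda>(e, f, a, b). (e - f, e, a)) \<in>
          {(e, f, a, b). e \<in> E \<and> f \<in> F \<and> a \<in> A \<and> b \<in> A \<and> e - f = a - b} \<rightarrow> Sigma D S"
        by (auto simp: S_def D_def) (metis cancel)
    qed (auto simp: S_def, metis cancel)
  qed
  finally show ?thesis .
qed

lemma cross_energy_mono:
  assumes "finite E" "finite F" "finite A" "B \<subseteq> A"
  shows "cross_energy E F B \<le> cross_energy E F A"
  unfolding cross_energy_def using assms
  by (intro card_mono finite_quadruples) auto

section \<open>Behaviour of \<open>T2\<close> under splitting\<close>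

text \<open>
  In the cycle \<open>a\<^sub>1 \<rightarrow> a\<^sub>1' \<rightarrow> a\<^sub>2 \<rightarrow> a\<^sub>2' \<rightarrow> a\<^sub>1\<close> of a quadruple that is not contained in \<open>E\<close> or in
  \<open>F\<close>, some arrow leads from \<open>E\<close> to \<open>F\<close>; each of the four arrows contributes one cross energy.
\<close>

lemma T2_union_le:
  fixes E F :: "'a::ab_group_add set"
  assumes "finite E" "finite F"
  shows "T2 (E \<union> F) \<le> T2 E + T2 F + 4 * cross_energy E F (E \<union> F)"
proof -
  define Q where "Q X = {(a, b, c, d). a \<in> X \<and> b \<in> X \<and> c \<in> X \<and> d \<in> X \<and> a + b = c + d}"
    for X :: "'a set"
  define K where "K = {(e, f, a, b). e \<in> E \<and> f \<in> F \<and> a \<in> E \<union> F \<and> b \<in> E \<union> F \<and> e - f = a - b}"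
  define h1 h2 h3 h4 :: "'a \<times> 'a \<times> 'a \<times> 'a \<Rightarrow> 'a \<times> 'a \<times> 'a \<times> 'a"
    where h_defs: "h1 = (\<lambda>(e, f, a, b). (e, b, f, a))" "h2 = (\<lambda>(e, f, a, b). (a, f, e, b))"
      "h3 = (\<lambda>(e, f, a, b). (b, e, a, f))" "h4 = (\<lambda>(e, f, a, b). (f, a, b, e))"
  have finK: "finite K" and finQ: "finite (Q E)" "finite (Q F)"
    unfolding K_def Q_def using assms
    by (simp_all only: finite_quadruples finite_UnI)
  have sub: "Q (E \<union> F) \<subseteq> Q E \<union> Q F \<union> (h1 ` K \<union> h2 ` K \<union> h3 ` K \<union> h4 ` K)"
  proof
    fix q assume "q \<in> Q (E \<union> F)"
    then obtain a b c d where q: "q = (a, b, c, d)"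
      and mem: "a \<in> E \<union> F" "b \<in> E \<union> F" "c \<in> E \<union> F" "d \<in> E \<union> F" and eq: "a + b = c + d"
      by (auto simp: Q_def)
    \<comment> \<open>The same equation solved for the difference along each of the four arrows, in
      the shape \<open>e - f = a - b\<close> required by \<open>K\<close>.\<close>
    have swap: "a - c = d - b" "c - b = a - d" "b - d = c - a" "d - a = b - c"
      using eq by (simp_all add: algebra_simps)
    consider "q \<in> Q E" | "q \<in> Q F" | "a \<in> E" "c \<in> F" | "c \<in> E" "b \<in> F"
      | "b \<in> E" "d \<in> F" | "d \<in> E" "a \<in> F"
      using mem eq unfolding q Q_def by blast
    then show "q \<in> Q E \<union> Q F \<union> (h1 ` K \<union> h2 ` K \<union> h3 ` K \<union> h4 ` K)"
    proof cases
      case 3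
      then have "(a, c, d, b) \<in> K" using mem swap by (auto simp: K_def)
      then have "h1 (a, c, d, b) \<in> h1 ` K" by (rule imageI)
      then show ?thesis by (simp add: h_defs q)
    next
      case 4
      then have "(c, b, a, d) \<in> K" using mem swap by (auto simp: K_def)
      then have "h2 (c, b, a, d) \<in> h2 ` K" by (rule imageI)
      then show ?thesis by (simp add: h_defs q)
    next
      case 5
      then have "(b, d, c, a) \<in> K" using mem swap by (auto simp: K_def)
      then have "h3 (b, d, c, a) \<in> h3 ` K" by (rule imageI)
      then show ?thesis by (simp add: h_defs q)
    next
      case 6
      then have "(d, a, b, c) \<in> K" using mem swap by (auto simp: K_def)
      then have "h4 (d, a, b, c) \<in> h4 ` K" by (rule imageI)
      then show ?thesis by (simp add: h_defs q)
    qed auto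
  qed
  have "card (Q (E \<union> F)) \<le> card (Q E \<union> Q F \<union> (h1 ` K \<union> h2 ` K \<union> h3 ` K \<union> h4 ` K))"
    using sub by (rule card_mono[rotated]) (use finK finQ in auto)
  also have "\<dots> \<le> card (Q E) + card (Q F)
      + (card (h1 ` K) + card (h2 ` K) + card (h3 ` K) + card (h4 ` K))"
    by (intro order.trans[OF card_Un_le] add_mono order.refl)
  also have "\<dots> \<le> card (Q E) + card (Q F) + (card K + card K + card K + card K)"
    using finK by (intro add_mono card_image_le order.refl)
  finally show ?thesis
    unfolding T2_def cross_energy_def Q_def K_def by simp
qed

text \<open>No quadruple lies in both disjoint sets. This superadditivity lets loss bounds
  proportional to \<open>T2\<close> of the parts be charged to \<open>T2\<close> of the
  whole.\<close>

lemma T2_union_ge: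
  fixes E F :: "'a::ab_group_add set"
  assumes "finite E" "finite F" "E \<inter> F = {}"
  shows "T2 E + T2 F \<le> T2 (E \<union> F)"
proof -
  define Q where "Q X = {(a, b, c, d). a \<in> X \<and> b \<in> X \<and> c \<in> X \<and> d \<in> X \<and> a + b = c + d}"
    for X :: "'a set"
  have fin: "finite (Q E)" "finite (Q F)" "finite (Q (E \<union> F))"
    unfolding Q_def using assms by (simp_all only: finite_quadruples finite_UnI)
  have "Q E \<inter> Q F = {}" and sub: "Q E \<union> Q F \<subseteq> Q (E \<union> F)"
    using assms(3) by (auto simp: Q_def)
  then have "card (Q E) + card (Q F) = card (Q E \<union> Q F)"
    using fin by (simp add: card_Un_disjoint)
  also have "\<dots> \<le> card (Q (E \<union> F))"
    using fin(3) sub by (rule card_mono)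
  finally show ?thesis
    unfolding T2_def Q_def .
qed

section \<open>Strong connectivity and its failure\<close>

definition strongly_connected :: "real \<Rightarrow> real \<Rightarrow> 'a::ab_group_add set \<Rightarrow> bool" where
  "strongly_connected \<beta> C P \<longleftrightarrow> (\<exists>B\<subseteq>P. \<beta> * real (card P) \<le> real (card B) \<and>
    (\<forall>E F. E \<inter> F = {} \<and> E \<union> F = B \<longrightarrow>
      C * (real (card E) / real (card P)) * (real (card F) / real (card P)) * real (T2 P)
        \<le> real (cross_energy E F P)))"

text \<open>The lower bound is monotone in the constant, so one set \<open>B\<close> chosen for
  \<open>C\<close> serves every smaller \<open>C'\<close>.\<close>

lemma strongly_connected_imp_le:
  assumes "strongly_connected \<beta> C P" "finite P"
  shows "\<exists>B. B \<subseteq> P \<and> real (card B) \<ge> \<beta> * real (card P) \<and>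
      (\<forall>C' E F. 0 < C' \<and> C' \<le> C \<and> E \<inter> F = {} \<and> E \<union> F = B \<longrightarrow>
        Sum_any (\<lambda>x. (indicator E \<circ>\<^sub>G indicator F) x * (indicator P \<circ>\<^sub>G indicator P) x)
          \<ge> C' * (real (card E) / real (card P)) * (real (card F) / real (card P))
              * real (T2 P))"
proof -
  obtain B where B: "B \<subseteq> P" "\<beta> * real (card P) \<le> real (card B)"
    and split: "\<forall>E F. E \<inter> F = {} \<and> E \<union> F = B \<longrightarrow>
      C * (real (card E) / real (card P)) * (real (card F) / real (card P)) * real (T2 P)
        \<le> real (cross_energy E F P)"
    using assms(1) unfolding strongly_connected_def by (elim exE conjE)
  have "C' * (real (card E) / real (card P)) * (real (card F) / real (card P)) * real (T2 P)
      \<le> Sum_any (\<lambda>x. (indicator E \<circ>\<^sub>G indicator F) x * (indicator P \<circ>\<^sub>G indicator P) x)"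
    if "C' \<le> C" "E \<inter> F = {}" "E \<union> F = B" for C' E F
  proof -
    have fin: "finite E" "finite F"
      using that B(1) assms(2) by (auto intro: finite_subset)
    have "C' * (real (card E) / real (card P)) * (real (card F) / real (card P)) * real (T2 P)
      \<le> C * (real (card E) / real (card P)) * (real (card F) / real (card P)) * real (T2 P)"
      using that(1) by (intro mult_right_mono) auto
    also have "\<dots> \<le> real (cross_energy E F P)"
      using split that(2,3) by simp
    finally show ?thesis
      using fin assms(2) by (simp add: Sum_any_diff_conv)
  qed
  then show ?thesis using B by (intro exI[of _ B]) simp
qed

text \<open>Failure of connectivity gives a bad split of every dense \<open>B\<close>. The bound is
  arranged so that the coefficient of \<open>|E| |F|\<close> depends on \<open>A\<close> only, which
  allows the losses of successive splits to be added.\<close>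

lemma not_strongly_connectedE:
  assumes "\<not> strongly_connected \<beta> C A" "B \<subseteq> A" "\<beta> * real (card A) \<le> real (card B)" "finite A"
  obtains E F where "E \<inter> F = {}" "E \<union> F = B" "E \<noteq> {}" "F \<noteq> {}"
    "real (cross_energy E F A)
      \<le> C * real (T2 A) / (real (card A))\<^sup>2 * (real (card E) * real (card F))"
proof -
  obtain E F where EF: "E \<inter> F = {}" "E \<union> F = B"
    and less: "real (cross_energy E F A)
      < C * (real (card E) / real (card A)) * (real (card F) / real (card A)) * real (T2 A)"
    using assms(1-3) unfolding strongly_connected_def by (meson not_le)
  \<comment> \<open>If one part were empty, both sides of the strict inequality would be 0.\<close>
  have "E \<noteq> {}" "F \<noteq> {}"
    using less by (auto simp: cross_energy_def)
  moreover have "C * (real (card E) / real (card A)) * (real (card F) / real (card A)) * real (T2 A)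
      = C * real (T2 A) / (real (card A))\<^sup>2 * (real (card E) * real (card F))"
    by (simp add: power2_eq_square)
  ultimately show thesis
    using that[OF EF] less by linarith
qed

text \<open>Otherwise a singleton would be dense enough to be split into two nonempty parts.\<close>

lemma card_gt_if_not_strongly_connected:
  assumes "\<not> strongly_connected \<beta> C A" "A \<noteq> {}" "finite A"
  shows "1 < \<beta> * real (card A)"
proof (rule ccontr)
  assume "\<not> 1 < \<beta> * real (card A)"
  moreover obtain a where "a \<in> A" using assms(2) by blast
  ultimately have "{a} \<subseteq> A" "\<beta> * real (card A) \<le> real (card {a})" by simp_all
  from not_strongly_connectedE[OF assms(1) this assms(3)]
  obtain E F where "E \<inter> F = {}" "E \<union> F = {a}" "E \<noteq> {}" "F \<noteq> {}" .
  then show False by (auto simp: Un_singleton_iff)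
qed

section \<open>Partition into strongly connected blocks\<close>

lemma partition_on_Un:
  assumes "partition_on A P" "partition_on B Q" "A \<inter> B = {}"
  shows "partition_on (A \<union> B) (P \<union> Q)"
  using assms by (simp add: partition_on_def disjoint_union)

lemma partition_on_disjnt:
  assumes "partition_on A P" "partition_on B Q" "A \<inter> B = {}"
  shows "P \<inter> Q = {}"
proof (rule ccontr)
  assume "P \<inter> Q \<noteq> {}"
  then obtain p where "p \<in> P" "p \<in> Q" by blast
  then have "p \<subseteq> A \<inter> B" "p \<noteq> {}"
    using assms(1,2) by (auto simp: partition_on_def)
  with assms(3) show False by simp
qed

text \<open>Two nested inductions on cardinality: the inner one splits subsets of a fixed
  \<open>A\<close>, with losses measured against \<open>T2 A\<close>; the outer one takes over once
  a piece has density below \<open>\<beta>\<close> in \<open>A\<close>.\<close>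

lemma strongly_connected_partition_exists:
  fixes A :: "'a::ab_group_add set"
  assumes "0 < \<beta>" "\<beta> < 1" "0 \<le> C" "finite A" "A \<noteq> {}"
  shows "\<exists>\<P>. partition_on A \<P> \<and> (\<forall>P\<in>\<P>. strongly_connected \<beta> C P) \<and>
    (1 - 2 * C * log (1 / \<beta>) (real (card A))) * real (T2 A) \<le> (\<Sum>P\<in>\<P>. real (T2 P))"
  using assms(4,5)
proof (induction "card A" arbitrary: A rule: less_induct)
  case less
  have base: "1 < 1 / \<beta>" using assms by simp
  have cA: "1 \<le> real (card A)"
    using less.prems by (simp add: Suc_leI card_gt_0_iff)
  show ?case
  proof (cases "strongly_connected \<beta> C A")
    case True
    have "0 \<le> 2 * C * log (1 / \<beta>) (real (card A)) * real (T2 A)"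
      using assms(3) base cA by simp
    with True less.prems(2) show ?thesis
      by (intro exI[of _ "{A}"]) (auto simp: partition_on_def disjoint_def algebra_simps)
  next
    case False
    note gt = card_gt_if_not_strongly_connected[OF False less.prems(2,1)]
    \<comment> \<open>Loss rate allowed for later rounds: a piece smaller than \<open>A\<close> by
      the factor \<open>\<beta>\<close> has a logarithm smaller by at least 1.\<close>
    define \<mu> where "\<mu> = 2 * C * (log (1 / \<beta>) (real (card A)) - 1)"
    \<comment> \<open>Chosen so that a split of \<open>B\<close> into \<open>E\<close> and
      \<open>F\<close> loses at most
      \<open>2 \<kappa> |E| |F| = \<kappa> (|B|^2 - |E|^2 - |F|^2)\<close>. Thus
      \<open>\<kappa> |B|^2\<close> is a budget for all splits inside \<open>B\<close>.\<close>
    define \<kappa> where "\<kappa> = 2 * C * real (T2 A) / (real (card A))\<^sup>2"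
    have "log (1 / \<beta>) (1 / \<beta>) \<le> log (1 / \<beta>) (real (card A))"
      using gt base assms(1) cA by (intro log_mono) (auto simp: field_simps)
    moreover have "log (1 / \<beta>) (1 / \<beta>) = 1"
      by (rule log_eq_one) (use base in linarith)+
    ultimately have \<mu>0: "0 \<le> \<mu>"
      using assms(3) by (simp add: \<mu>_def)
    have \<kappa>0: "0 \<le> \<kappa>"
      using assms(3) by (simp add: \<kappa>_def)
    have pieces: "\<exists>\<P>. partition_on B \<P> \<and> (\<forall>P\<in>\<P>. strongly_connected \<beta> C P) \<and>
        (1 - \<mu>) * real (T2 B) - \<kappa> * (real (card B))\<^sup>2 \<le> (\<Sum>P\<in>\<P>. real (T2 P))"
      if "B \<subseteq> A" "B \<noteq> {}" for B
      using that
    proof (induction "card B" arbitrary: B rule: less_induct)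
      case inner: less
      have finB: "finite B"
        using inner.prems(1) less.prems(1) by (rule finite_subset)
      have cB: "1 \<le> real (card B)"
        using finB inner.prems(2) by (simp add: Suc_leI card_gt_0_iff)
      show ?case
      proof (cases "\<beta> * real (card A) \<le> real (card B)")
        case large: True
        obtain E F where EF: "E \<inter> F = {}" "E \<union> F = B" "E \<noteq> {}" "F \<noteq> {}"
          and cross: "real (cross_energy E F A)
            \<le> C * real (T2 A) / (real (card A))\<^sup>2 * (real (card E) * real (card F))"
          using not_strongly_connectedE[OF False inner.prems(1) large less.prems(1)] .
        have fin: "finite E" "finite F" using finB EF(2) by auto
        have cards: "card B = card E + card F"
          using card_Un_disjoint[OF fin EF(1)] EF(2) by simp
        have "card E < card B" "card F < card B"
          using cards fin EF(3,4) by (simp_all add: card_gt_0_iff)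
        moreover have "E \<subseteq> A" "F \<subseteq> A" using EF(2) inner.prems(1) by auto
        ultimately obtain \<P> \<Q> where
          \<P>: "partition_on E \<P>" "\<forall>P\<in>\<P>. strongly_connected \<beta> C P"
            "(1 - \<mu>) * real (T2 E) - \<kappa> * (real (card E))\<^sup>2 \<le> (\<Sum>P\<in>\<P>. real (T2 P))" and
          \<Q>: "partition_on F \<Q>" "\<forall>P\<in>\<Q>. strongly_connected \<beta> C P"
            "(1 - \<mu>) * real (T2 F) - \<kappa> * (real (card F))\<^sup>2 \<le> (\<Sum>P\<in>\<Q>. real (T2 P))"
          using inner.hyps EF(3,4) by metis
        have part: "partition_on B (\<P> \<union> \<Q>)"
          using partition_on_Un[OF \<P>(1) \<Q>(1) EF(1)] EF(2) by simp
        have "\<P> \<inter> \<Q> = {}"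
          using partition_on_disjnt[OF \<P>(1) \<Q>(1) EF(1)] .
        moreover have "finite \<P>" "finite \<Q>"
          using fin \<P>(1) \<Q>(1) by (auto intro: finite_elements)
        ultimately have sum_eq: "(\<Sum>P\<in>\<P> \<union> \<Q>. real (T2 P))
            = (\<Sum>P\<in>\<P>. real (T2 P)) + (\<Sum>P\<in>\<Q>. real (T2 P))"
          by (intro sum.union_disjoint) auto
        have "T2 B \<le> T2 E + T2 F + 4 * cross_energy E F B"
          using T2_union_le[OF fin] EF(2) by simp
        also have "\<dots> \<le> T2 E + T2 F + 4 * cross_energy E F A"
          using cross_energy_mono[OF fin less.prems(1) inner.prems(1)] by simp
        finally have "real (T2 B) \<le> real (T2 E + T2 F + 4 * cross_energy E F A)"
          by (simp only: of_nat_le_iff)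
        then have upper: "real (T2 B)
            \<le> real (T2 E) + real (T2 F) + 2 * (\<kappa> * (real (card E) * real (card F)))"
          using cross by (simp add: \<kappa>_def)
        \<comment> \<open>The later losses of both parts together fit into the allowance of
          \<open>B\<close>.\<close>
        have "\<mu> * real (T2 E + T2 F) \<le> \<mu> * real (T2 B)"
          using T2_union_ge[OF fin EF(1)] EF(2) \<mu>0 by (intro mult_left_mono) auto
        then have lower: "\<mu> * real (T2 E) + \<mu> * real (T2 F) \<le> \<mu> * real (T2 B)"
          by (simp add: distrib_left)
        \<comment> \<open>The mixed term of the square pays exactly for the present split; the two
          squares are the budgets of the parts.\<close>
        have "\<kappa> * (real (card B))\<^sup>2 = \<kappa> * (real (card E))\<^sup>2 + \<kappa> * (real (card F))\<^sup>2
            + 2 * (\<kappa> * (real (card E) * real (card F)))"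
          by (simp add: cards power2_eq_square algebra_simps)
        then have "(1 - \<mu>) * real (T2 B) - \<kappa> * (real (card B))\<^sup>2
            \<le> (\<Sum>P\<in>\<P> \<union> \<Q>. real (T2 P))"
          using \<P>(3) \<Q>(3) upper lower by (simp add: sum_eq left_diff_distrib)
        then show ?thesis
          using part \<P>(2) \<Q>(2) by (intro exI[of _ "\<P> \<union> \<Q>"]) auto
      next
        case small: False
        have "\<beta> * real (card A) \<le> 1 * real (card A)"
          using assms(2) by (intro mult_right_mono) auto
        with small have "card B < card A" by linarith
        from less.hyps[OF this finB inner.prems(2)] obtain \<P> where
          \<P>: "partition_on B \<P>" "\<forall>P\<in>\<P>. strongly_connected \<beta> C P"
            "(1 - 2 * C * log (1 / \<beta>) (real (card B))) * real (T2 B) \<le> (\<Sum>P\<in>\<P>. real (T2 P))"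
          by blast
        \<comment> \<open>Dividing by the base \<open>1 / \<beta>\<close> lowers the logarithm by 1,
          so the rate from the outer induction is at most \<open>\<mu>\<close>; the
          \<open>\<kappa>\<close> budget is left over.\<close>
        have "log (1 / \<beta>) (real (card B)) \<le> log (1 / \<beta>) (real (card A) / (1 / \<beta>))"
          using small base cB by (intro log_mono) (auto simp: mult.commute)
        also have "\<dots> = log (1 / \<beta>) (real (card A)) - 1"
          using base cA assms(1) by (subst log_divide) auto
        finally have "2 * C * log (1 / \<beta>) (real (card B)) \<le> \<mu>"
          unfolding \<mu>_def using assms(3) by (intro mult_left_mono) auto
        then have "(1 - \<mu>) * real (T2 B)
            \<le> (1 - 2 * C * log (1 / \<beta>) (real (card B))) * real (T2 B)"
          by (intro mult_right_mono) auto
        moreover have "0 \<le> \<kappa> * (real (card B))\<^sup>2" using \<kappa>0 by simp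
        ultimately show ?thesis
          using \<P> by (intro exI[of _ \<P>]) auto
      qed
    qed
    \<comment> \<open>For \<open>B = A\<close> the budget equals \<open>2 C T2 A\<close>, which
      restores the 1 subtracted from the logarithm in \<open>\<mu>\<close>.\<close>
    have "\<kappa> * (real (card A))\<^sup>2 = 2 * C * real (T2 A)"
      using cA by (simp add: \<kappa>_def)
    then have "(1 - \<mu>) * real (T2 A) - \<kappa> * (real (card A))\<^sup>2
        = (1 - 2 * C * log (1 / \<beta>) (real (card A))) * real (T2 A)"
      by (simp add: \<mu>_def algebra_simps)
    with pieces[OF order.refl less.prems(2)] show ?thesis by simp
  qed
qed

section \<open>Choice of the constant and enumeration of the blocks\<close>

theorem theorem4p9:
  fixes A :: "'a::ab_group_add set" and \<epsilon> \<beta> C\<^sub>0 :: real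
  assumes "finite A"
    and "0 < \<epsilon>" "\<epsilon> < 1" "0 < \<beta>" "\<beta> < 1"
    and "real (card A) \<ge> \<epsilon> / (2 * \<beta>\<^sup>2)"
    and "C\<^sub>0 = \<epsilon> * log 2 (1 / \<beta>) / (3 * log 2 (2 * real (card A) / \<epsilon>))"
  shows "\<exists>(t::nat) (P :: nat \<Rightarrow> 'a set) (\<Omega> :: 'a set).
    (\<Union>i\<in>{1..t}. P i) \<union> \<Omega> = A \<and>
    disjoint_family_on P {1..t} \<and>
    (\<forall>i\<in>{1..t}. P i \<inter> \<Omega> = {}) \<and>
    (\<forall>i\<in>{1..t}. P i \<noteq> {}) \<and>
    (\<forall>i\<in>{1..t}. \<exists>B. B \<subseteq> P i \<and> real (card B) \<ge> \<beta> * real (card (P i)) \<and>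
      (\<forall>C E F. 0 < C \<and> C \<le> C\<^sub>0 \<and> E \<inter> F = {} \<and> E \<union> F = B \<longrightarrow>
        Sum_any (\<lambda>x. (indicator E \<circ>\<^sub>G indicator F) x * (indicator (P i) \<circ>\<^sub>G indicator (P i)) x)
          \<ge> C * (real (card E) / real (card (P i))) * (real (card F) / real (card (P i)))
              * real (T2 (P i)))) \<and>
    (\<Sum>i=1..t. real (T2 (P i))) \<ge> (1 - \<epsilon>) * real (T2 A)"
proof (cases "A = {}")
  case True
  then have "T2 A = 0" by (simp add: T2_def case_prod_unfold)
  with True show ?thesis
    by (intro exI[of _ 0] exI[of _ "\<lambda>_. {}"] exI[of _ "{}"]) (simp add: disjoint_family_on_def)
next
  case False
  define n where "n = real (card A)"
  have n: "1 \<le> n"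
    using False assms(1) by (simp add: n_def Suc_leI card_gt_0_iff)
  \<comment> \<open>Makes the logarithm in the denominator of \<open>C\<^sub>0\<close> positive and
    at least \<open>log 2 n\<close>.\<close>
  have "2 * n * 1 \<le> 2 * n * (1 / \<epsilon>)"
    using n assms(2,3) by (intro mult_left_mono) auto
  then have big: "n \<le> 2 * n / \<epsilon>" "1 < 2 * n / \<epsilon>"
    using n by simp_all
  have base: "1 < 1 / \<beta>" using assms(4,5) by simp
  have logs: "0 < log 2 (1 / \<beta>)" "0 < log 2 (2 * n / \<epsilon>)" "log 2 n \<le> log 2 (2 * n / \<epsilon>)"
    using base big n by (intro zero_less_log_cancel_iff[THEN iffD2] log_mono; linarith)+
  have C0: "0 \<le> C\<^sub>0"
    using logs assms(2) by (simp add: assms(7) n_def)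
  \<comment> \<open>Changing to base 2 cancels \<open>log 2 (1 / \<beta>)\<close> against the
    numerator of \<open>C\<^sub>0\<close>. What remains is \<open>2 / 3 * \<epsilon>\<close> times a
    ratio of logarithms that is at most 1.\<close>
  have "2 * C\<^sub>0 * log (1 / \<beta>) n = 2 * C\<^sub>0 * (log 2 n / log 2 (1 / \<beta>))"
    using base n by (subst log_base_change[of 2 "1 / \<beta>"]) auto
  also have "\<dots> = 2 / 3 * \<epsilon> * (log 2 n / log 2 (2 * n / \<epsilon>))"
    using logs unfolding assms(7) n_def[symmetric] by (simp add: field_simps)
  also have "\<dots> \<le> 2 / 3 * \<epsilon> * 1"
    using logs assms(2) by (intro mult_left_mono) auto
  also have "\<dots> \<le> \<epsilon>" using assms(2) by simp
  finally have loss: "2 * C\<^sub>0 * log (1 / \<beta>) n \<le> \<epsilon>" .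
  obtain \<P> where \<P>: "partition_on A \<P>" "\<forall>P\<in>\<P>. strongly_connected \<beta> C\<^sub>0 P"
    "(1 - 2 * C\<^sub>0 * log (1 / \<beta>) n) * real (T2 A) \<le> (\<Sum>P\<in>\<P>. real (T2 P))"
    using strongly_connected_partition_exists[OF assms(4,5) C0 assms(1) False]
    unfolding n_def by blast
  have "finite \<P>" using assms(1) \<P>(1) by (rule finite_elements)
  then obtain p where p: "bij_betw p {1..card \<P>} \<P>"
    using ex_bij_betw_nat_finite_1 by blast
  then have p_mem: "p i \<in> \<P>" if "i \<in> {1..card \<P>}" for i
    using that by (auto simp: bij_betw_def)
  have "disjoint_family_on p {1..card \<P>}"
    unfolding disjoint_family_on_def
  proof (intro ballI impI)
    fix i j assume ij: "i \<in> {1..card \<P>}" "j \<in> {1..card \<P>}" "i \<noteq> j"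
    then have "p i \<noteq> p j"
      using inj_onD[OF bij_betw_imp_inj_on[OF p]] by metis
    then show "p i \<inter> p j = {}"
      using disjointD[OF partition_onD2[OF \<P>(1)]] p_mem ij(1,2) by simp
  qed
  \<comment> \<open>The blocks already cover \<open>A\<close>, so \<open>\<Omega>\<close> is taken
    to be empty.\<close>
  moreover have "(\<Union>i\<in>{1..card \<P>}. p i) \<union> {} = A"
    using p partition_onD1[OF \<P>(1)] by (simp add: bij_betw_def)
  moreover have "\<forall>i\<in>{1..card \<P>}. p i \<noteq> {}"
    using p_mem partition_onD3[OF \<P>(1)] by metis
  moreover have "finite (p i)" if "i \<in> {1..card \<P>}" for i
    using p_mem[OF that] partition_onD1[OF \<P>(1)] assms(1) by (auto intro: finite_subset)
  then have "\<forall>i\<in>{1..card \<P>}. \<exists>B. B \<subseteq> p i \<and> real (card B) \<ge> \<beta> * real (card (p i)) \<and>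
      (\<forall>C E F. 0 < C \<and> C \<le> C\<^sub>0 \<and> E \<inter> F = {} \<and> E \<union> F = B \<longrightarrow>
        Sum_any (\<lambda>x. (indicator E \<circ>\<^sub>G indicator F) x * (indicator (p i) \<circ>\<^sub>G indicator (p i)) x)
          \<ge> C * (real (card E) / real (card (p i))) * (real (card F) / real (card (p i)))
              * real (T2 (p i)))"
    using p_mem \<P>(2) by (intro ballI strongly_connected_imp_le) auto
  moreover have "(1 - \<epsilon>) * real (T2 A) \<le> (\<Sum>i=1..card \<P>. real (T2 (p i)))"
  proof -
    have "(1 - \<epsilon>) * real (T2 A) \<le> (1 - 2 * C\<^sub>0 * log (1 / \<beta>) n) * real (T2 A)"
      using loss by (intro mult_right_mono) auto
    also note \<P>(3)
    also have "(\<Sum>P\<in>\<P>. real (T2 P)) = (\<Sum>i=1..card \<P>. real (T2 (p i)))"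
      using sum.reindex_bij_betw[OF p, of "\<lambda>P. real (T2 P)"] by simp
    finally show ?thesis .
  qed
  ultimately show ?thesis
    by (intro exI[of _ "card \<P>"] exI[of _ p] exI[of _ "{}"]) simp
qed

end
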